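(* Let $G$ be a finite simple connected graph with $n$ vertices that is not a tree, with a designated sink vertex. The spectral gap $\gamma_d$ of the discrete time sandpile chain on $G$ satisfies $$\gamma_d\le\frac{4\pi^2}{\beta_1^2\,n},$$ where $0=\beta_0<\beta_1\le\cdots\le\beta_{n-1}$ are the eigenvalues of the full Laplacian $\overline{\Delta}$ of $G$.
   Context: With $V=\{v_1,\dots,v_n\}$, the full Laplacian $\overline{\Delta}$ is the $n\times n$ matrix with $\overline{\Delta}(i,i)=\deg(v_i)$, $\overline{\Delta}(i,j)=-1$ if $v_i\sim v_j$, and $0$ otherwise. A multiplicative harmonic function on $G$ with sink $s$ is a function $h:V\to\mathbb{C}^*$ with $h(s)=1$ and $h(v)^{\deg(v)}=\prod_{w\sim v}h(w)$ for all $v\in V$ (such $h$ automatically have $|h|\equiv1$). $\mathcal{H}$ is the finite set of all such functions. For $h\in\mathcal{H}$ put $\lambda_h=\frac1n\sum_{v\in V}h(v)$; these are the eigenvalues of the sandpile chain. The discrete time spectral gap is $\gamma_d=\min\{1-|\lambda_h|:h\in\mathcal{H},\,h\not\equiv1\}$. *)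

theory Defs
  imports
    "Graph_Theory.Pair_Digraph"
    "Graph_Theory.Digraph_Component"
    "Jordan_Normal_Form.Char_Poly"
    "HOL-Library.FuncSet"
begin

text \<open>
  A finite simple graph is a \<^locale>\<open>pair_graph\<close>: each undirected edge is represented by its
  two arcs, so the degree of a vertex is its out-degree and the neighbours of \<open>v\<close> are the \<open>w\<close>
  with \<open>(v, w) \<in> parcs G\<close>.

  The constant \<^const>\<open>tree\<close> of Graph_Theory is not usable for such graphs: the back-and-forth
  walk along a single edge is a directed cycle. Cycles of the undirected simple graph are
  the directed cycles of length at least 3.
\<close>
definition undirected_tree :: "'a pair_pre_digraph \<Rightarrow> bool" where
  "undirected_tree G \<longleftrightarrow> Digraph_Component.connected (with_proj G) \<and>
     \<not> (\<exists>p. pre_digraph.cycle (with_proj G) p \<and> 3 \<le> length p)"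

definition full_laplacian :: "'a pair_pre_digraph \<Rightarrow> (nat \<Rightarrow> 'a) \<Rightarrow> real mat" where
  "full_laplacian G vs = mat (card (pverts G)) (card (pverts G))
     (\<lambda>(i, j). if i = j then real (out_degree (with_proj G) (vs i))
              else if (vs i, vs j) \<in> parcs G then -1 else 0)"

text \<open>
  The real eigenvalues of a matrix in increasing order, repeated according to their algebraic
  multiplicity. For a symmetric \<open>n \<times> n\<close> matrix, such as a Laplacian, all eigenvalues are real
  and the list has length \<open>n\<close>.
\<close>
definition ordered_eigenvalues :: "real mat \<Rightarrow> real list" where
  "ordered_eigenvalues A = sorted_list_of_multiset (proots (char_poly A))"

text \<open>
  Extensionality (values outside the vertex set are \<^const>\<open>undefined\<close>) makes equality of
  functions coincide with equality on the vertices, so that this set is finite for connected \<open>G\<close>.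
\<close>
definition mult_harmonic :: "'a pair_pre_digraph \<Rightarrow> 'a \<Rightarrow> ('a \<Rightarrow> complex) set" where
  "mult_harmonic G s = {h \<in> pverts G \<rightarrow>\<^sub>E (UNIV - {0}). h s = 1 \<and>
     (\<forall>v \<in> pverts G. h v ^ out_degree (with_proj G) v = (\<Prod>w | (v, w) \<in> parcs G. h w))}"

definition sandpile_eigenvalue :: "'a pair_pre_digraph \<Rightarrow> ('a \<Rightarrow> complex) \<Rightarrow> complex" where
  "sandpile_eigenvalue G h = 1 / of_nat (card (pverts G)) * (\<Sum>v \<in> pverts G. h v)"

definition discrete_spectral_gap :: "'a pair_pre_digraph \<Rightarrow> 'a \<Rightarrow> real" where
  "discrete_spectral_gap G s =
     Min {1 - cmod (sandpile_eigenvalue G h) | h.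
       h \<in> mult_harmonic G s \<and> (\<exists>v \<in> pverts G. h v \<noteq> 1)}"

end

theory Submission
  imports Defs "HOL-Analysis.Function_Topology"
begin

text \<open>
  If \<open>f\<close> is a real function on the vertices with integral Laplacian, then \<open>h = exp (2\<pi>i (f - f s))\<close> is
  multiplicative harmonic, and \<open>cos x \<ge> 1 - x\<^sup>2 / 2\<close> gives \<open>1 - \<bar>\<lambda>\<^sub>h\<bar> \<le> 2\<pi>\<^sup>2 \<parallel>f\<parallel>\<^sup>2 / n\<close>. For an arc \<open>(u, v)\<close>
  let \<open>f\<close> be the solution of \<open>\<Delta> f = e\<^sub>u - e\<^sub>v\<close> orthogonal to the constants. Expanding in an orthonormal
  eigenbasis shows \<open>\<parallel>f\<parallel>\<^sup>2 \<le> 2 / \<beta>\<^sub>1\<^sup>2\<close>, which is the bound. The function \<open>h\<close> is nontrivial if \<open>(u, v)\<close> lies on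
  a cycle: otherwise \<open>f\<close> is integral up to a constant, and then the set \<open>{x. f u \<le> f x}\<close> has only
  \<open>(u, v)\<close> in its boundary.
\<close>

section \<open>Spectral theorem for real symmetric matrices\<close>

text \<open>Vectors are functions on all of \<open>nat\<close> of which only the values below
  \<open>n\<close> count. This avoids dimension conditions and makes compactness of products of
  intervals available for the unit sphere.\<close>

definition dotp :: "nat \<Rightarrow> (nat \<Rightarrow> real) \<Rightarrow> (nat \<Rightarrow> real) \<Rightarrow> real" where
  "dotp n x y = (\<Sum>i<n. x i * y i)"

definition matvec :: "nat \<Rightarrow> (nat \<Rightarrow> nat \<Rightarrow> real) \<Rightarrow> (nat \<Rightarrow> real) \<Rightarrow> nat \<Rightarrow> real" where
  "matvec n A x i = (\<Sum>j<n. A i j * x j)"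

lemma dotp_commute: "dotp n x y = dotp n y x"
  by (simp add: dotp_def mult.commute)

lemma dotp_cong:
  "(\<And>i. i < n \<Longrightarrow> x i = x' i) \<Longrightarrow> (\<And>i. i < n \<Longrightarrow> y i = y' i) \<Longrightarrow> dotp n x y = dotp n x' y'"
  by (simp add: dotp_def)

lemma dotp_lincomb_left: "dotp n (\<lambda>i. x i + c * y i) z = dotp n x z + c * dotp n y z"
  by (simp add: dotp_def sum.distrib sum_distrib_left algebra_simps)

lemma dotp_lincomb_right: "dotp n z (\<lambda>i. x i + c * y i) = dotp n z x + c * dotp n z y"
  by (metis dotp_commute dotp_lincomb_left)

lemma dotp_scale_right: "dotp n z (\<lambda>i. c * y i) = c * dotp n z y"
  by (simp add: dotp_def sum_distrib_left algebra_simps)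

lemma dotp_scale_left: "dotp n (\<lambda>i. c * y i) z = c * dotp n y z"
  by (metis dotp_commute dotp_scale_right)

lemma dotp_self_nonneg: "0 \<le> dotp n x x"
  by (simp add: dotp_def sum_nonneg)

lemma dotp_self_eq_0: "dotp n x x = 0 \<longleftrightarrow> (\<forall>i<n. x i = 0)"
  by (auto simp: dotp_def sum_nonneg_eq_0_iff)

lemma matvec_lincomb: "matvec n A (\<lambda>i. x i + c * y i) = (\<lambda>i. matvec n A x i + c * matvec n A y i)"
  by (simp add: matvec_def sum.distrib sum_distrib_left algebra_simps fun_eq_iff)

lemma matvec_scale: "matvec n A (\<lambda>i. c * y i) = (\<lambda>i. c * matvec n A y i)"
  by (simp add: matvec_def sum_distrib_left algebra_simps fun_eq_iff)

lemma matvec_selfadjoint: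
  assumes "\<And>i j. i < n \<Longrightarrow> j < n \<Longrightarrow> A i j = A j i"
  shows "dotp n x (matvec n A y) = dotp n (matvec n A x) y"
proof -
  have "dotp n x (matvec n A y) = (\<Sum>i<n. \<Sum>j<n. A i j * x i * y j)"
    by (simp add: dotp_def matvec_def sum_distrib_left algebra_simps)
  also have "\<dots> = (\<Sum>j<n. \<Sum>i<n. A j i * x i * y j)"
    using assms by (subst sum.swap) simp
  also have "\<dots> = dotp n (matvec n A x) y"
    by (simp add: dotp_def matvec_def sum_distrib_left sum_distrib_right algebra_simps)
  finally show ?thesis .
qed

section \<open>Eigenvectors by minimising the Rayleigh quotient\<close>

lemma compact_PiE_UNIV:
  fixes S :: "'i \<Rightarrow> 'b::topological_space set"
  assumes "\<And>i. compact (S i)"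
  shows "compact (PiE UNIV S)"
proof -
  have "compactin (product_topology (\<lambda>_. euclidean) UNIV) (PiE UNIV S)"
    using assms by (simp add: compactin_PiE)
  then show ?thesis
    by (simp add: euclidean_product_topology)
qed

text \<open>The projection onto the span of the \<open>q j\<close> has trace \<open>k < n\<close>,
  so it moves some standard basis vector; the residual of that vector, normalised, is the required
  one.\<close>

lemma exists_unit_orthogonal:
  assumes "k < n"
    and orth: "\<And>i j. i < k \<Longrightarrow> j < k \<Longrightarrow> dotp n (q i) (q j) = (if i = j then 1 else 0)"
  obtains x where "dotp n x x = 1" "\<And>j. j < k \<Longrightarrow> dotp n (q j) x = 0"
proof -
  \<comment> \<open>\<open>r a\<close> is the \<open>a\<close>-th standard basis vector minus its
    orthogonal projection onto the span of the \<open>q j\<close>.\<close>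
  define r where "r a b = (if b = a then 1 else 0) - (\<Sum>j<k. q j a * q j b)" for a b
  have r_orth: "dotp n (q i) (r a) = 0" if "i < k" "a < n" for i a
  proof -
    have "dotp n (q i) (r a) = (\<Sum>b<n. q i b * (if b = a then 1 else 0)) - (\<Sum>b<n. \<Sum>j<k. q j a * (q i b * q j b))"
      by (simp add: dotp_def r_def algebra_simps sum_subtractf sum_distrib_left)
    also have "(\<Sum>b<n. \<Sum>j<k. q j a * (q i b * q j b)) = (\<Sum>j<k. q j a * dotp n (q i) (q j))"
      by (subst sum.swap) (simp add: dotp_def sum_distrib_left)
    also have "\<dots> = (\<Sum>j<k. if i = j then q j a else 0)"
      using that orth by (intro sum.cong) auto
    also have "\<dots> = q i a"
      using that by simp
    finally show ?thesis
      using that by (simp add: if_distrib sum.delta cong: if_cong)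
  qed
  have "\<exists>a<n. dotp n (r a) (r a) \<noteq> 0"
  proof (rule ccontr)
    assume "\<not> ?thesis"
    then have zero: "r a a = 0" if "a < n" for a
      using that by (auto simp: dotp_self_eq_0)
    \<comment> \<open>The trace of the projection in two ways: \<open>n\<close> from the diagonal
      entries, each 1 if all residuals vanish, and \<open>k\<close> from the unit norms of the
      \<open>q j\<close>.\<close>
    have "real n = (\<Sum>a<n. \<Sum>j<k. q j a * q j a)"
      using zero by (simp add: r_def)
    also have "\<dots> = (\<Sum>j<k. dotp n (q j) (q j))"
      by (subst sum.swap) (simp add: dotp_def)
    also have "\<dots> = real k"
      by (simp add: orth)
    finally show False
      using \<open>k < n\<close> by simp
  qed
  then obtain a where a: "a < n" "dotp n (r a) (r a) \<noteq> 0" by blast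
  let ?c = "1 / sqrt (dotp n (r a) (r a))"
  show ?thesis
  proof (rule that[of "\<lambda>i. ?c * r a i"])
    show "dotp n (\<lambda>i. ?c * r a i) (\<lambda>i. ?c * r a i) = 1"
      unfolding dotp_scale_left dotp_scale_right
      using a dotp_self_nonneg[of n "r a"] by simp
    show "dotp n (q j) (\<lambda>i. ?c * r a i) = 0" if "j < k" for j
      unfolding dotp_scale_right using r_orth[OF that a(1)] by simp
  qed
qed

lemma continuous_on_dotp [continuous_intros]:
  fixes f g :: "'c::topological_space \<Rightarrow> nat \<Rightarrow> real"
  assumes "\<And>i. continuous_on S (\<lambda>x. f x i)" "\<And>i. continuous_on S (\<lambda>x. g x i)"
  shows "continuous_on S (\<lambda>x. dotp n (f x) (g x))"
  unfolding dotp_def by (intro continuous_intros assms)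

lemma continuous_on_matvec [continuous_intros]:
  fixes f :: "'c::topological_space \<Rightarrow> nat \<Rightarrow> real"
  assumes "\<And>i. continuous_on S (\<lambda>x. f x i)"
  shows "continuous_on S (\<lambda>x. matvec n A (f x) i)"
  unfolding matvec_def by (intro continuous_intros assms)

text \<open>The quadratic form is continuous and attains its minimum on the compact set of unit
  vectors orthogonal to the \<open>q j\<close>; homogeneity of degree two carries the bound over to
  all \<open>y\<close>.\<close>

lemma exists_rayleigh_minimizer:
  assumes "k < n"
    and orth: "\<And>i j. i < k \<Longrightarrow> j < k \<Longrightarrow> dotp n (q i) (q j) = (if i = j then 1 else 0)"
  obtains x where "dotp n x x = 1" "\<And>j. j < k \<Longrightarrow> dotp n (q j) x = 0"
    "\<And>y. (\<And>j. j < k \<Longrightarrow> dotp n (q j) y = 0) \<Longrightarrow>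
       dotp n x (matvec n A x) * dotp n y y \<le> dotp n y (matvec n A y)"
proof -
  \<comment> \<open>Coordinates from \<open>n\<close> on are pinned to 0 and the others confined to
    an interval, since the norm condition alone does not give a compact set of functions on
    \<open>nat\<close>.\<close>
  define K where "K = PiE UNIV (\<lambda>i. if i < n then {-1..1::real} else {0}) \<inter>
    {x. dotp n x x = 1} \<inter> (\<Inter>j\<in>{..<k}. {x. dotp n (q j) x = 0})"
  have "compact (PiE UNIV (\<lambda>i. if i < n then {-1..1::real} else {0}))"
    by (rule compact_PiE_UNIV) auto
  moreover have "closed {x. dotp n x x = 1}"
    by (intro closed_Collect_eq continuous_intros continuous_on_product_coordinates)
  moreover have "closed (\<Inter>j\<in>{..<k}. {x. dotp n (q j) x = 0})"
    by (intro closed_INT ballI closed_Collect_eq continuous_intros continuous_on_product_coordinates)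
  ultimately have "compact K"
    unfolding K_def by (intro compact_Int_closed)
  \<comment> \<open>Truncating a vector to its first \<open>n\<close> coordinates leaves all dot
    products unchanged.\<close>
  have K_I: "(\<lambda>i. if i < n then x i else 0) \<in> K"
    if x: "dotp n x x = 1" "\<And>j. j < k \<Longrightarrow> dotp n (q j) x = 0" for x
  proof -
    have "\<bar>x i\<bar> \<le> 1" if "i < n" for i
    proof -
      have "x i * x i \<le> dotp n x x"
        unfolding dotp_def using that by (intro member_le_sum) auto
      then show ?thesis
        using x(1) by (simp add: flip: abs_square_le_1 power2_eq_square)
    qed
    moreover have "dotp n (\<lambda>i. if i < n then x i else 0) (\<lambda>i. if i < n then x i else 0) = 1"
      using x(1) by (simp add: dotp_def)
    moreover have "dotp n (q j) (\<lambda>i. if i < n then x i else 0) = 0" if "j < k" for j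
      using x(2)[OF that] by (simp add: dotp_def)
    ultimately show ?thesis
      unfolding K_def by (auto simp: PiE_iff abs_le_iff minus_le_iff)
  qed
  obtain x0 where "dotp n x0 x0 = 1" "\<And>j. j < k \<Longrightarrow> dotp n (q j) x0 = 0"
    using exists_unit_orthogonal[OF assms] by blast
  then have "K \<noteq> {}"
    using K_I by blast
  have "continuous_on K (\<lambda>x. dotp n x (matvec n A x))"
    by (intro continuous_intros continuous_on_subset[OF continuous_on_product_coordinates]) auto
  from continuous_attains_inf[OF \<open>compact K\<close> \<open>K \<noteq> {}\<close> this]
  obtain x where x: "x \<in> K" and min: "\<And>y. y \<in> K \<Longrightarrow> dotp n x (matvec n A x) \<le> dotp n y (matvec n A y)"
    by blast
  show ?thesis
  proof (rule that[of x])
    show "dotp n x x = 1" "\<And>j. j < k \<Longrightarrow> dotp n (q j) x = 0"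
      using x by (auto simp: K_def)
    fix y assume y: "\<And>j. j < k \<Longrightarrow> dotp n (q j) y = 0"
    show "dotp n x (matvec n A x) * dotp n y y \<le> dotp n y (matvec n A y)"
    proof (cases "dotp n y y = 0")
      case True
      then have "\<forall>i<n. y i = 0" by (simp add: dotp_self_eq_0)
      then show ?thesis
        by (simp add: dotp_def)
    next
      case False
      then have pos: "dotp n y y > 0"
        using dotp_self_nonneg[of n y] by simp
      define c where "c = 1 / sqrt (dotp n y y)"
      have cc: "c * c * dotp n y y = 1"
        using pos by (simp add: c_def)
      let ?z = "\<lambda>i. c * y i"
      have "dotp n ?z ?z = 1"
        unfolding dotp_scale_left dotp_scale_right using cc by (simp add: mult.assoc)
      moreover have "dotp n (q j) ?z = 0" if "j < k" for j
        unfolding dotp_scale_right using y[OF that] by simp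
      ultimately have "(\<lambda>i. if i < n then ?z i else 0) \<in> K"
        by (rule K_I)
      from min[OF this] have "dotp n x (matvec n A x) \<le> dotp n ?z (matvec n A ?z)"
        by (simp add: dotp_def matvec_def)
      also have "\<dots> = c * c * dotp n y (matvec n A y)"
        unfolding matvec_scale dotp_scale_left dotp_scale_right by simp
      finally have "dotp n x (matvec n A x) * dotp n y y \<le> c * c * dotp n y (matvec n A y) * dotp n y y"
        using pos by (simp add: mult_right_mono)
      also have "\<dots> = c * c * dotp n y y * dotp n y (matvec n A y)" by simp
      also have "\<dots> = dotp n y (matvec n A y)" using cc by simp
      finally show ?thesis .
    qed
  qed
qed

text \<open>The quadratic has its minimum 0 at \<open>t = 0\<close>, so its derivative
  \<open>2 * a\<close> there vanishes.\<close>

lemma linear_term_eq_0: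
  fixes a b :: real
  assumes "\<And>t. 0 \<le> 2 * t * a + t\<^sup>2 * b"
  shows "a = 0"
proof (rule ccontr)
  assume "a \<noteq> 0"
  \<comment> \<open>With this denominator the quadratic term is at most \<open>- (t * a)\<close>,
    half the size of the linear one, which forces \<open>t * a \<ge> 0\<close>, although the sign of
    \<open>t\<close> makes \<open>t * a\<close> negative.\<close>
  define t where "t = - a / (\<bar>b\<bar> + 1)"
  have ta: "t * (\<bar>b\<bar> + 1) = - a" by (simp add: t_def)
  have "t\<^sup>2 * b \<le> t\<^sup>2 * (\<bar>b\<bar> + 1)"
    by (intro mult_left_mono) auto
  also have "\<dots> = - (t * a)"
    using ta by (metis minus_mult_right mult.assoc power2_eq_square)
  finally have "0 \<le> t * a"
    using assms[of t] by simp
  moreover have "t * a = - (a\<^sup>2 / (\<bar>b\<bar> + 1))"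
    by (simp add: t_def power2_eq_square)
  moreover have "a\<^sup>2 / (\<bar>b\<bar> + 1) > 0"
    using \<open>a \<noteq> 0\<close> by (intro divide_pos_pos) auto
  ultimately show False by simp
qed

text \<open>The residual \<open>z = A x - m x\<close> is orthogonal to the \<open>q j\<close>,
  because \<open>A\<close> is self-adjoint and the \<open>q j\<close> are eigenvectors. Hence
  \<open>x + t z\<close> is an admissible competitor for every \<open>t\<close>, and the first-order
  condition at \<open>t = 0\<close> says that \<open>z\<close> has norm 0.\<close>

lemma rayleigh_minimizer_eigenvector:
  assumes sym: "\<And>i j. i < n \<Longrightarrow> j < n \<Longrightarrow> A i j = A j i"
    and eig: "\<And>j i. j < k \<Longrightarrow> i < n \<Longrightarrow> matvec n A (q j) i = l j * q j i"
    and x: "dotp n x x = 1" "\<And>j. j < k \<Longrightarrow> dotp n (q j) x = 0"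
    and min: "\<And>y. (\<And>j. j < k \<Longrightarrow> dotp n (q j) y = 0) \<Longrightarrow>
       m * dotp n y y \<le> dotp n y (matvec n A y)"
    and m: "m = dotp n x (matvec n A x)"
    and "i < n"
  shows "matvec n A x i = m * x i"
proof -
  define z where "z = (\<lambda>i. matvec n A x i + (- m) * x i)"
  have z_orth: "dotp n (q j) z = 0" if "j < k" for j
  proof -
    have "dotp n (q j) (matvec n A x) = dotp n (matvec n A (q j)) x"
      by (rule matvec_selfadjoint[OF sym])
    also have "\<dots> = dotp n (\<lambda>i. l j * q j i) x"
      using eig[OF that] by (intro dotp_cong) auto
    also have "\<dots> = 0"
      unfolding dotp_scale_left using x(2)[OF that] by simp
    finally show ?thesis
      unfolding z_def dotp_lincomb_right using x(2)[OF that] by simp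
  qed
  let ?a = "dotp n z (matvec n A x) - m * dotp n z x"
  let ?b = "dotp n z (matvec n A z) - m * dotp n z z"
  have "0 \<le> 2 * t * ?a + t\<^sup>2 * ?b" for t
  proof -
    let ?y = "\<lambda>i. x i + t * z i"
    have "m * dotp n ?y ?y \<le> dotp n ?y (matvec n A ?y)"
      by (rule min) (simp add: dotp_lincomb_right x z_orth)
    moreover have "dotp n ?y ?y = 1 + 2 * t * dotp n z x + t\<^sup>2 * dotp n z z"
      by (simp add: dotp_lincomb_right dotp_lincomb_left x dotp_commute[of n x z] power2_eq_square algebra_simps)
    moreover have "dotp n ?y (matvec n A ?y) = m + 2 * t * dotp n z (matvec n A x) + t\<^sup>2 * dotp n z (matvec n A z)"
      using matvec_selfadjoint[OF sym, where x = x and y = z] 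
      by (simp add: matvec_lincomb dotp_lincomb_right dotp_lincomb_left m power2_eq_square
          algebra_simps dotp_commute[of n "matvec n A x" z])
    ultimately show ?thesis
      by (simp add: algebra_simps)
  qed
  then have "?a = 0"
    by (rule linear_term_eq_0)
  moreover have "?a = dotp n z z"
    using dotp_lincomb_right[of n z "matvec n A x" "- m" x] by (simp add: z_def)
  ultimately show ?thesis
    using \<open>i < n\<close> by (simp add: dotp_self_eq_0 z_def)
qed

text \<open>Induction on \<open>k\<close>: the next vector is a Rayleigh minimiser on the orthogonal
  complement of the earlier ones. The minimality in the last conjunct is carried along because it
  makes the eigenvalues increase.\<close>

lemma exists_orthonormal_eigenvectors:
  assumes sym: "\<forall>i<n. \<forall>j<n. A i j = A j i"
    and "k \<le> n"
  shows "\<exists>q l. (\<forall>i<k. \<forall>j<k. dotp n (q i) (q j) = (if i = j then 1 else 0)) \<and>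
     (\<forall>j<k. \<forall>i<n. matvec n A (q j) i = l j * q j i) \<and>
     (\<forall>i j. i \<le> j \<longrightarrow> j < k \<longrightarrow> l i \<le> l j) \<and>
     (\<forall>j<k. \<forall>y. (\<forall>i<j. dotp n (q i) y = 0) \<longrightarrow> l j * dotp n y y \<le> dotp n y (matvec n A y))"
  using \<open>k \<le> n\<close>
proof (induction k)
  case 0
  then show ?case by simp
next
  case (Suc k)
  from Suc.IH[OF Suc_leD[OF Suc.prems]] obtain q l where
    "\<forall>i<k. \<forall>j<k. dotp n (q i) (q j) = (if i = j then 1 else 0)"
    "\<forall>j<k. \<forall>i<n. matvec n A (q j) i = l j * q j i"
    "\<forall>i j. i \<le> j \<longrightarrow> j < k \<longrightarrow> l i \<le> l j"
    "\<forall>j<k. \<forall>y. (\<forall>i<j. dotp n (q i) y = 0) \<longrightarrow> l j * dotp n y y \<le> dotp n y (matvec n A y)"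
    by (elim exE conjE)
  note orth = this(1)[rule_format] and eig = this(2)[rule_format]
    and mono = this(3)[rule_format] and min = this(4)[rule_format]
  obtain x where x: "dotp n x x = 1" "\<And>j. j < k \<Longrightarrow> dotp n (q j) x = 0" and
    xmin: "\<And>y. (\<And>j. j < k \<Longrightarrow> dotp n (q j) y = 0) \<Longrightarrow>
       dotp n x (matvec n A x) * dotp n y y \<le> dotp n y (matvec n A y)"
    using exists_rayleigh_minimizer[of k n q A] orth Suc.prems by auto
  define m where "m = dotp n x (matvec n A x)"
  have xeig: "matvec n A x i = m * x i" if "i < n" for i
    by (rule rayleigh_minimizer_eigenvector[OF sym[rule_format] eig x _ m_def that])
      (auto simp: m_def intro: xmin)
  \<comment> \<open>The new vector \<open>x\<close> was already a competitor when \<open>q j\<close>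
    was chosen.\<close>
  have lm: "l j \<le> m" if "j < k" for j
    using min[OF that, of x] x that by (simp add: m_def)
  let ?q = "q(k := x)" and ?l = "l(k := m)"
  have orth': "dotp n (?q i) (?q j) = (if i = j then 1 else 0)" if "i < Suc k" "j < Suc k" for i j
    using that orth[of i j] x(1) x(2)[of i] x(2)[of j] dotp_commute[of n x "q j"]
    by (cases "i = k"; cases "j = k") simp_all
  have eig': "matvec n A (?q j) i = ?l j * ?q j i" if "j < Suc k" "i < n" for i j
    using that eig[of j i] xeig[of i] by (cases "j = k") simp_all
  have mono': "?l i \<le> ?l j" if "i \<le> j" "j < Suc k" for i j
    using that mono[of i j] lm[of i] by (cases "j = k"; cases "i = k") simp_all
  have min': "?l j * dotp n y y \<le> dotp n y (matvec n A y)"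
    if "j < Suc k" "\<forall>i<j. dotp n (?q i) y = 0" for j y
  proof -
    have "dotp n (q i) y = 0" if "i < j" for i
      using that \<open>j < Suc k\<close> \<open>\<forall>i<j. dotp n (?q i) y = 0\<close>[rule_format, of i] by simp
    then show ?thesis
      using that(1) min[of j y] xmin[of y] by (cases "j = k") (simp_all add: m_def)
  qed
  show ?case
    by (intro exI[of _ ?q] exI[of _ ?l] conjI allI impI)
      (rule orth' eig' mono' min'; assumption)+
qed

lemma symmetric_spectral:
  assumes sym: "\<And>i j. i < n \<Longrightarrow> j < n \<Longrightarrow> A i j = A j i"
  obtains q l where
    "\<And>i j. i < n \<Longrightarrow> j < n \<Longrightarrow> dotp n (q i) (q j) = (if i = j then 1 else 0)"
    "\<And>j i. j < n \<Longrightarrow> i < n \<Longrightarrow> matvec n A (q j) i = l j * q j i"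
    "\<And>i j. i \<le> j \<Longrightarrow> j < n \<Longrightarrow> l i \<le> l j"
proof -
  have "\<forall>i<n. \<forall>j<n. A i j = A j i"
    using sym by simp
  from exists_orthonormal_eigenvectors[OF this order_refl] obtain q l where
    *: "\<forall>i<n. \<forall>j<n. dotp n (q i) (q j) = (if i = j then 1 else 0)"
    "\<forall>j<n. \<forall>i<n. matvec n A (q j) i = l j * q j i"
    "\<forall>i j. i \<le> j \<longrightarrow> j < n \<longrightarrow> l i \<le> l j"
    by (elim exE conjE)
  show ?thesis
    by (rule that[of q l]) (rule *[rule_format]; assumption)+
qed

section \<open>Completeness and the sorted list of eigenvalues\<close>

lemma orthonormal_complete:
  assumes "\<And>i j. i < n \<Longrightarrow> j < n \<Longrightarrow> dotp n (q i) (q j) = (if i = j then 1 else 0)"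
    and "a < n" "b < n"
  shows "(\<Sum>j<n. q j a * q j b) = (if a = b then 1 else 0)"
proof -
  define P where "P = mat n n (\<lambda>(i, j). q j i)"
  have P: "P \<in> carrier_mat n n" "transpose_mat P \<in> carrier_mat n n"
    by (auto simp: P_def)
  \<comment> \<open>The columns of \<open>P\<close> are the \<open>q j\<close>. A left inverse of a
    square matrix is also a right inverse, and the entries of \<open>P * transpose_mat P\<close> are
    the sums in question.\<close>
  have "transpose_mat P * P = 1\<^sub>m n"
    by (rule eq_matI)
      (auto simp: P_def scalar_prod_def assms(1)[unfolded dotp_def] atLeast0LessThan)
  then have "P * transpose_mat P = 1\<^sub>m n"
    using P by (metis mat_mult_left_right_inverse)
  then have "(P * transpose_mat P) $$ (a, b) = (if a = b then 1 else 0)"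
    using assms by simp
  then show ?thesis
    using assms(2,3) by (simp add: P_def scalar_prod_def atLeast0LessThan)
qed

text \<open>The matrix is similar to the diagonal matrix of the \<open>l j\<close>, so both have the
  same characteristic polynomial, and its roots with multiplicity are the \<open>l j\<close>. This
  links the minimisation values to the eigenvalues defined by the characteristic polynomial.\<close>

lemma ordered_eigenvalues_eq:
  assumes orth: "\<And>i j. i < n \<Longrightarrow> j < n \<Longrightarrow> dotp n (q i) (q j) = (if i = j then 1 else 0)"
    and eig: "\<And>j i. j < n \<Longrightarrow> i < n \<Longrightarrow> matvec n A (q j) i = l j * q j i"
    and mono: "\<And>i j. i \<le> j \<Longrightarrow> j < n \<Longrightarrow> l i \<le> l j"
  shows "ordered_eigenvalues (mat n n (\<lambda>(i, j). A i j)) = map l [0..<n]"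
proof -
  define M where "M = mat n n (\<lambda>(i, j). A i j)"
  define P where "P = mat n n (\<lambda>(i, j). q j i)"
  define D where "D = mat n n (\<lambda>(i, j). if i = j then l i else 0)"
  have carr: "M \<in> carrier_mat n n" "P \<in> carrier_mat n n" "transpose_mat P \<in> carrier_mat n n" "D \<in> carrier_mat n n"
    by (auto simp: P_def M_def D_def)
  have PP: "transpose_mat P * P = 1\<^sub>m n"
    by (rule eq_matI) (auto simp: P_def scalar_prod_def orth[unfolded dotp_def] atLeast0LessThan)
  then have PP': "P * transpose_mat P = 1\<^sub>m n"
    using carr by (metis mat_mult_left_right_inverse)
  have "M * P = P * D"
  proof (rule eq_matI)
    fix i j assume "i < dim_row (P * D)" "j < dim_col (P * D)"
    then have ij: "i < n" "j < n" by (auto simp: P_def D_def)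
    have "(P * D) $$ (i, j) = (\<Sum>k<n. if k = j then q k i * l k else 0)"
      using ij by (simp add: P_def D_def scalar_prod_def atLeast0LessThan if_distrib cong: if_cong)
    also have "\<dots> = q j i * l j"
      using ij by simp
    also have "\<dots> = (M * P) $$ (i, j)"
      using ij eig[OF ij(2,1)] by (simp add: M_def P_def scalar_prod_def matvec_def atLeast0LessThan)
    finally show "(M * P) $$ (i, j) = (P * D) $$ (i, j)" ..
  qed (auto simp: M_def P_def D_def)
  then have "P * D * transpose_mat P = M * (P * transpose_mat P)"
    using carr by (metis assoc_mult_mat)
  then have "M = P * D * transpose_mat P"
    using carr PP' by simp
  then have "similar_mat M D"
    using carr PP PP' by (intro similar_matI[of _ _ P "transpose_mat P" n]) auto
  then have "char_poly M = char_poly D"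
    by (rule char_poly_similar)
  also have "\<dots> = (\<Prod>a \<leftarrow> diag_mat D. [:- a, 1:])"
    using carr by (intro char_poly_upper_triangular[of D n]) (auto simp: D_def)
  also have "diag_mat D = map l [0..<n]"
    by (auto simp: diag_mat_def D_def)
  finally have "char_poly M = (\<Prod>a \<leftarrow> map l [0..<n]. [:- a, 1:])" .
  moreover have "proots (\<Prod>a \<leftarrow> xs. [:- a, 1:]) = mset xs" for xs :: "real list"
    by (induction xs) (simp_all add: proots_mult prod_list_zero_iff image_iff del: mult_pCons_left)
  ultimately have "proots (char_poly M) = mset (map l [0..<n])"
    by metis
  moreover have "sorted (map l [0..<n])"
    using mono by (auto simp: sorted_iff_nth_mono)
  ultimately show ?thesis
    unfolding ordered_eigenvalues_def M_def[symmetric]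
    by (metis sorted_list_of_multiset_mset sorted_sort_id)
qed

section \<open>The graph Laplacian\<close>

text \<open>The operator on vertex functions, free of any enumeration of the vertices;
  \<open>full_laplacian_entry_sum\<close> identifies it with the matrix.\<close>

definition laplacian :: "'a pair_pre_digraph \<Rightarrow> ('a \<Rightarrow> real) \<Rightarrow> 'a \<Rightarrow> real" where
  "laplacian G f v = (\<Sum>w | (v, w) \<in> parcs G. f v - f w)"

text \<open>\<open>connected\<close> means strong connectivity of the symmetrised graph, so
  induction along a path from \<open>x\<close> never leaves \<open>S\<close>.\<close>

lemma connected_closed_set_eq_verts:
  assumes conn: "Digraph_Component.connected (with_proj G)"
    and S: "S \<subseteq> pverts G" "x \<in> S"
    and closed: "\<And>v w. (v, w) \<in> parcs G \<Longrightarrow> v \<in> S \<longleftrightarrow> w \<in> S"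
  shows "S = pverts G"
proof
  show "pverts G \<subseteq> S"
  proof
    fix y assume "y \<in> pverts G"
    then have "x \<rightarrow>\<^sup>*\<^bsub>with_proj (mk_symmetric (with_proj G))\<^esub> y"
      using conn S by (auto simp: connected_def strongly_connected_def mk_symmetric_def)
    moreover have "parcs (mk_symmetric (with_proj G)) = parcs G \<union> (parcs G)\<inverse>"
      by (auto simp: mk_symmetric_def intro: rev_bexI)
    ultimately have "(x, y) \<in> rtrancl_on (pverts G) (parcs G \<union> (parcs G)\<inverse>)"
      by (simp add: reachable_def mk_symmetric_def)
    then show "y \<in> S"
      using closed S by (induction rule: rtrancl_on_induct) auto
  qed
qed (rule S)

context pair_graph
begin

lemma finite_neighbours [simp]: "finite {w. (v, w) \<in> parcs G}"
  by (rule finite_subset[OF _ finite_imageI[OF pair_finite_arcs, of snd]]) force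

lemma neighbours_subset: "{w. (v, w) \<in> parcs G} \<subseteq> pverts G"
  using in_arcsD2 by blast

lemma out_degree_eq_card_neighbours:
  "out_degree (with_proj G) v = card {w. (v, w) \<in> parcs G}"
proof -
  have "out_arcs (with_proj G) v = Pair v ` {w. (v, w) \<in> parcs G}"
    by (auto simp: out_arcs_def)
  then show ?thesis
    by (simp add: out_degree_def card_image inj_on_def)
qed

lemma arc_swap: "(v, w) \<in> parcs G \<longleftrightarrow> (w, v) \<in> parcs G"
  using pair_sym_arcs by (auto simp: symmetric_def sym_def)

section \<open>Divergence theorem, Dirichlet energy and maximum principle\<close>

lemma sum_laplacian_eq_sum_arcs:
  assumes "S \<subseteq> pverts G"
  shows "(\<Sum>v\<in>S. c v * laplacian G f v) = (\<Sum>(v, w)\<in>{e \<in> parcs G. fst e \<in> S}. c v * (f v - f w))"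
proof -
  have "finite S"
    using assms pair_finite_verts by (rule finite_subset)
  then have "(\<Sum>v\<in>S. c v * laplacian G f v) = (\<Sum>(v, w)\<in>Sigma S (\<lambda>v. {w. (v, w) \<in> parcs G}). c v * (f v - f w))"
    by (simp add: laplacian_def sum_distrib_left sum.Sigma)
  also have "Sigma S (\<lambda>v. {w. (v, w) \<in> parcs G}) = {e \<in> parcs G. fst e \<in> S}"
    by auto
  finally show ?thesis .
qed

lemma sum_arcs_swap:
  assumes "A \<subseteq> parcs G" "A\<inverse> = A"
  shows "(\<Sum>(v, w)\<in>A. g v w) = (\<Sum>(v, w)\<in>A. g w v)"
  using assms(2)
  by (intro sum.reindex_bij_witness[of _ prod.swap prod.swap]) auto

text \<open>Discrete divergence theorem: arcs inside \<open>S\<close> come in opposite pairs whose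
  contributions cancel, which leaves the flow across the boundary.\<close>

lemma sum_laplacian_eq_boundary:
  assumes "S \<subseteq> pverts G"
  shows "(\<Sum>v\<in>S. laplacian G f v) = (\<Sum>(v, w)\<in>{(v, w) \<in> parcs G. v \<in> S \<and> w \<notin> S}. f v - f w)"
proof -
  define I where "I = {(v, w) \<in> parcs G. v \<in> S \<and> w \<in> S}"
  define B where "B = {(v, w) \<in> parcs G. v \<in> S \<and> w \<notin> S}"
  have "I\<inverse> = I"
    using arc_swap by (auto simp: I_def)
  then have "(\<Sum>(v, w)\<in>I. f v - f w) = (\<Sum>(v, w)\<in>I. f w - f v)"
    by (intro sum_arcs_swap) (auto simp: I_def)
  also have "\<dots> = - (\<Sum>(v, w)\<in>I. f v - f w)"
    by (simp add: sum_negf[symmetric] case_prod_unfold)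
  finally have "(\<Sum>(v, w)\<in>I. f v - f w) = 0"
    by simp
  moreover have "{e \<in> parcs G. fst e \<in> S} = I \<union> B"
    by (auto simp: I_def B_def)
  moreover have "finite I" "finite B" "I \<inter> B = {}"
    using pair_finite_arcs by (auto simp: I_def B_def intro: finite_subset[of _ "parcs G"])
  ultimately show ?thesis
    using sum_laplacian_eq_sum_arcs[OF assms, of "\<lambda>_. 1" f]
    by (simp add: B_def[symmetric] sum.union_disjoint)
qed

lemma sum_laplacian_verts: "(\<Sum>v\<in>pverts G. laplacian G f v) = 0"
proof -
  have "{(v, w) \<in> parcs G. v \<in> pverts G \<and> w \<notin> pverts G} = {}"
    using in_arcsD2 by auto
  then show ?thesis
    by (simp only: sum_laplacian_eq_boundary[OF order_refl] sum.empty)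
qed

text \<open>Averaging over the two orientations of each edge turns twice the energy into a sum of
  squares. This yields nonnegative eigenvalues.\<close>

lemma dirichlet_energy_nonneg: "0 \<le> (\<Sum>v\<in>pverts G. f v * laplacian G f v)"
proof -
  have arcs: "{e \<in> parcs G. fst e \<in> pverts G} = parcs G"
    using in_arcsD1 by auto
  have "2 * (\<Sum>v\<in>pverts G. f v * laplacian G f v) =
      (\<Sum>(v, w)\<in>parcs G. f v * (f v - f w)) + (\<Sum>(v, w)\<in>parcs G. f w * (f w - f v))"
    using sum_laplacian_eq_sum_arcs[of "pverts G" f f] sum_arcs_swap[of "parcs G" "\<lambda>v w. f v * (f v - f w)"] arc_swap
    unfolding arcs by (auto simp: converse_unfold)
  also have "\<dots> = (\<Sum>(v, w)\<in>parcs G. (f v - f w)\<^sup>2)"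
    by (simp add: sum.distrib[symmetric] case_prod_unfold power2_eq_square algebra_simps)
  also have "\<dots> \<ge> 0"
    by (intro sum_nonneg) auto
  finally show ?thesis by simp
qed

text \<open>Every arc leaving a superlevel set contributes positively to the sum of the Laplacian over it.\<close>
lemma superlevel_set_eq_verts:
  assumes conn: "Digraph_Component.connected (with_proj G)"
    and S: "S = {x \<in> pverts G. c \<le> f x}" "x \<in> S"
    and sum: "(\<Sum>v\<in>S. laplacian G f v) \<le> 0"
  shows "S = pverts G"
proof -
  define B where "B = {(v, w) \<in> parcs G. v \<in> S \<and> w \<notin> S}"
  have "finite B"
    using pair_finite_arcs by (auto simp: B_def intro: finite_subset[of _ "parcs G"])
  have pos: "f v - f w > 0" if "(v, w) \<in> B" for v w
    using that in_arcsD2 by (auto simp: B_def S)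
  have "(\<Sum>(v, w)\<in>B. f v - f w) \<le> 0"
    using sum sum_laplacian_eq_boundary[of S f] by (simp add: S B_def)
  then have "B = {}"
    using sum_pos[OF \<open>finite B\<close>, of "\<lambda>(v, w). f v - f w"] pos by (force split: prod.splits)
  then have "v \<in> S \<longleftrightarrow> w \<in> S" if "(v, w) \<in> parcs G" for v w
    using that arc_swap by (auto simp: B_def)
  then show ?thesis
    using connected_closed_set_eq_verts[OF conn _ S(2)] S(1) by blast
qed

text \<open>The superlevel set at height \<open>f x\<close> contains \<open>x\<close> and has
  Laplacian sum 0, so it is everything: each value of \<open>f\<close> is its minimum.\<close>

lemma laplacian_eq_0_imp_const:
  assumes conn: "Digraph_Component.connected (with_proj G)"
    and "\<And>v. v \<in> pverts G \<Longrightarrow> laplacian G f v = 0"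
    and "u \<in> pverts G" "v \<in> pverts G"
  shows "f u = f v"
proof -
  have "f x \<le> f y" if "x \<in> pverts G" "y \<in> pverts G" for x y
  proof -
    have "{z \<in> pverts G. f x \<le> f z} = pverts G"
      using assms(2) that by (intro superlevel_set_eq_verts[OF conn refl, of x]) (auto intro!: sum_nonpos)
    then show ?thesis using that by blast
  qed
  then show ?thesis
    using assms by (meson order_antisym)
qed

section \<open>Cycle arcs are not bridges\<close>

lemma pcas_enters_set:
  assumes "pcas x p y" "x \<notin> S" "y \<in> S"
  shows "\<exists>a b. (a, b) \<in> set p \<and> a \<notin> S \<and> b \<in> S"
  using assms
proof (induction p arbitrary: x)
  case (Cons e p)
  then show ?case
    by (cases e; cases "snd e \<in> S") (simp, blast, simp, metis)
qed simp

lemma in_set_pawalk_verts_fst: "(a, b) \<in> set p \<Longrightarrow> a \<in> set (pawalk_verts x p)"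
  by (induction p arbitrary: x) auto

lemma last_pawalk_verts: "pcas x p y \<Longrightarrow> last (pawalk_verts x p) = y"
  by (induction p arbitrary: x) (auto, (case_tac p; simp)+)

text \<open>As the vertices are distinct, only the first arc of \<open>p\<close> starts at
  \<open>v\<close>, so \<open>(v, u)\<close> would have to be that arc. Having at least two arcs,
  the walk would then leave \<open>u\<close> and end at \<open>u\<close> again, a
  repetition.\<close>

lemma long_cycle_avoids_reverse_arc:
  assumes "pcas u ((u, v) # p) u" "distinct (pawalk_verts v p)" "2 \<le> length p" "u \<noteq> v"
  shows "(v, u) \<notin> set p"
proof
  assume vu: "(v, u) \<in> set p"
  obtain x p' where p: "p = (v, x) # p'"
    using assms by (cases p) auto
  have "v \<notin> set (pawalk_verts x p')"
    using assms(2) p by simp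
  then have "(v, u) \<notin> set p'"
    using in_set_pawalk_verts_fst by metis
  then have "x = u"
    using vu p by auto
  moreover obtain y p'' where "p' = (u, y) # p''"
    using assms p \<open>x = u\<close> by (cases p') auto
  ultimately show False
    using assms p last_pawalk_verts[of y p'' u]
    by (cases p'') (auto split: if_splits)
qed

text \<open>
  An integral unit flow of gradient form crosses the boundary of \<open>{x. F u \<le> F x}\<close> along exactly one
  arc, so \<open>{u, v}\<close> would be a bridge.
\<close>
lemma dipole_not_integral:
  assumes conn: "Digraph_Component.connected (with_proj G)"
    and cyc: "pcas v p u" "set p \<subseteq> parcs G" "(v, u) \<notin> set p"
    and uv: "(u, v) \<in> parcs G"
    and F: "\<And>x. x \<in> pverts G \<Longrightarrow> F x \<in> \<int>"
    and lap: "\<And>x. x \<in> pverts G \<Longrightarrow> laplacian G F x = of_bool (x = u) - of_bool (x = v)"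
  shows False
proof -
  define S where "S = {x \<in> pverts G. F u \<le> F x}"
  have V: "u \<in> pverts G" "v \<in> pverts G" "u \<noteq> v"
    using uv in_arcsD1 in_arcsD2 pair_no_loops by fastforce+
  have S: "S \<subseteq> pverts G" "u \<in> S" "finite S"
    using V pair_finite_verts by (auto simp: S_def)
  have sum_S: "(\<Sum>x\<in>S. laplacian G F x) = 1 - of_bool (v \<in> S)"
  proof -
    have "(\<Sum>x\<in>S. laplacian G F x) = (\<Sum>x\<in>S. of_bool (x = u) - of_bool (x = v))"
      using S lap by (intro sum.cong) auto
    also have "\<dots> = 1 - of_bool (v \<in> S)"
      using S by (simp add: sum_subtractf of_bool_def)
    finally show ?thesis .
  qed
  \<comment> \<open>Otherwise the Laplacian sum over \<open>S\<close> is 0, \<open>S\<close> is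
    everything and \<open>u\<close> is a minimum of \<open>F\<close>, against Laplacian 1 at
    \<open>u\<close>.\<close>
  have "v \<notin> S"
  proof
    assume "v \<in> S"
    then have "S = pverts G"
      using superlevel_set_eq_verts[OF conn S_def S(2)] sum_S by simp
    then have "F u - F w \<le> 0" if "(u, w) \<in> parcs G" for w
      using in_arcsD2[OF that] by (auto simp: S_def)
    then have "laplacian G F u \<le> 0"
      unfolding laplacian_def by (intro sum_nonpos) auto
    then show False
      using lap[of u] V by simp
  qed
  \<comment> \<open>The walk from \<open>v\<close> to \<open>u\<close> enters \<open>S\<close> along
    \<open>(a, b)\<close>. The reverse \<open>(b, a)\<close> is a boundary arc, and it differs from
    \<open>(u, v)\<close> because the walk avoids \<open>(v, u)\<close>.\<close>
  then obtain a b where ab: "(a, b) \<in> set p" "a \<notin> S" "b \<in> S"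
    using pcas_enters_set[OF cyc(1), of S] S by blast
  define B where "B = {(x, y) \<in> parcs G. x \<in> S \<and> y \<notin> S}"
  have "finite B"
    using pair_finite_arcs by (auto simp: B_def intro: finite_subset[of _ "parcs G"])
  \<comment> \<open>Here integrality enters: a positive integral drop is at least 1, so two boundary
    arcs already exceed the total flow 1.\<close>
  have ge1: "1 \<le> F x - F y" if "(x, y) \<in> B" for x y
  proof -
    have "F x - F y \<in> \<int>" "F x - F y > 0"
      using that F in_arcsD1 in_arcsD2 by (auto simp: B_def S_def)
    then obtain k :: int where "F x - F y = of_int k" "k > 0"
      by (auto elim!: Ints_cases)
    then show ?thesis by simp
  qed
  have "(b, a) \<in> B" "(u, v) \<in> B" "(b, a) \<noteq> (u, v)"
    using ab cyc uv arc_swap S \<open>v \<notin> S\<close> by (auto simp: B_def)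
  then have "2 \<le> card B"
    using card_mono[OF \<open>finite B\<close>, of "{(b, a), (u, v)}"] by auto
  also have "real (card B) \<le> (\<Sum>(x, y)\<in>B. F x - F y)"
    using sum_mono[of B "\<lambda>_. 1" "\<lambda>(x, y). F x - F y"] ge1 by auto
  also have "\<dots> = 1"
    using sum_laplacian_eq_boundary[OF S(1), of F] sum_S \<open>v \<notin> S\<close> by (simp add: B_def)
  finally show False by simp
qed

text \<open>A cycle of length at least 3 is split into its first arc and the remaining walk, which
  returns to \<open>u\<close> without the reverse arc.\<close>

lemma not_tree_imp_cycle_arc:
  assumes "Digraph_Component.connected (with_proj G)" "\<not> undirected_tree G"
  obtains u v p where "(u, v) \<in> parcs G" "pcas v p u" "set p \<subseteq> parcs G" "(v, u) \<notin> set p"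
proof -
  obtain c where c: "cycle c" "3 \<le> length c"
    using assms by (auto simp: undirected_tree_def)
  then obtain u where u: "awalk u c u" "distinct (tl (pawalk_verts u c))"
    by (auto simp: cycle_def)
  obtain v p where vp: "c = (u, v) # p"
    using u c by (cases c) (auto simp: awalk_def)
  show ?thesis
  proof (rule that[of u v p])
    show "(u, v) \<in> parcs G" "pcas v p u" "set p \<subseteq> parcs G"
      using u vp by (auto simp: awalk_def)
    then show "(v, u) \<notin> set p"
      using u c vp pair_no_loops[of "(u, v)"]
      by (intro long_cycle_avoids_reverse_arc) (auto simp: awalk_def)
  qed
qed


section \<open>Eigenbasis of the Laplacian and the dipole potential\<close>

lemma laplacian_eq_degree:
  "laplacian G f v = real (out_degree (with_proj G) v) * f v - (\<Sum>w | (v, w) \<in> parcs G. f w)"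
  by (simp add: laplacian_def sum_subtractf out_degree_eq_card_neighbours)

lemma laplacian_lincomb:
  "laplacian G (\<lambda>x. \<Sum>j\<in>J. c j * f j x) v = (\<Sum>j\<in>J. c j * laplacian G (f j) v)"
  unfolding laplacian_def sum_distrib_left
  by (subst sum.swap) (simp add: sum_subtractf right_diff_distrib)

lemma full_laplacian_entry_sum:
  assumes bij: "bij_betw vs {..<n::nat} (pverts G)" and "i < n"
  shows "(\<Sum>j<n. (if i = j then real (out_degree (with_proj G) (vs i))
      else if (vs i, vs j) \<in> parcs G then -1 else 0) * f (vs j)) = laplacian G f (vs i)"
proof -
  have inj: "inj_on vs {..<n}" and img: "vs ` {..<n} = pverts G"
    using bij by (auto simp: bij_betw_def)
  have noloop: "(v, v) \<notin> parcs G" for v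
    using pair_no_loops[of "(v, v)"] by auto
  \<comment> \<open>Without loops the adjacency term vanishes at \<open>j = i\<close>, so degree and
    adjacency contributions can be summed separately.\<close>
  have "(\<Sum>j<n. (if i = j then real (out_degree (with_proj G) (vs i))
      else if (vs i, vs j) \<in> parcs G then -1 else 0) * f (vs j)) =
    (\<Sum>j<n. (if i = j then real (out_degree (with_proj G) (vs i)) * f (vs j) else 0)
       - (if (vs i, vs j) \<in> parcs G then f (vs j) else 0))"
    using noloop by (intro sum.cong) auto
  also have "\<dots> = real (out_degree (with_proj G) (vs i)) * f (vs i)
      - (\<Sum>j<n. if (vs i, vs j) \<in> parcs G then f (vs j) else 0)"
    using \<open>i < n\<close> by (subst sum_subtractf, subst sum.delta') auto
  also have "(\<Sum>j<n. if (vs i, vs j) \<in> parcs G then f (vs j) else 0) =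
      (\<Sum>w\<in>pverts G. if (vs i, w) \<in> parcs G then f w else 0)"
    using sum.reindex[OF inj, of "\<lambda>w. if (vs i, w) \<in> parcs G then f w else 0"] by (simp add: img)
  also have "\<dots> = (\<Sum>w | (vs i, w) \<in> parcs G. f w)"
    using neighbours_subset pair_finite_verts
    by (subst sum.inter_filter[symmetric]) (auto intro!: sum.cong)
  finally show ?thesis
    by (simp add: laplacian_eq_degree)
qed

text \<open>Carries the spectral theorem from indices to vertices through the inverse of
  \<open>vs\<close>. Orthonormality serves to compute the norm of an expansion, completeness to
  expand point masses.\<close>

lemma laplacian_eigenbasis:
  assumes bij: "bij_betw vs {..<n} (pverts G)" and n: "n = card (pverts G)"
  obtains Q l where
    "ordered_eigenvalues (full_laplacian G vs) = map l [0..<n]"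
    "\<And>i j. i \<le> j \<Longrightarrow> j < n \<Longrightarrow> l i \<le> l j"
    "\<And>i j. i < n \<Longrightarrow> j < n \<Longrightarrow> (\<Sum>x\<in>pverts G. Q i x * Q j x) = (if i = j then 1 else 0)"
    "\<And>x y. x \<in> pverts G \<Longrightarrow> y \<in> pverts G \<Longrightarrow> (\<Sum>j<n. Q j x * Q j y) = (if x = y then 1 else 0)"
    "\<And>j x. j < n \<Longrightarrow> x \<in> pverts G \<Longrightarrow> laplacian G (Q j) x = l j * Q j x"
proof -
  define A where "A = (\<lambda>i j. if i = j then real (out_degree (with_proj G) (vs i))
              else if (vs i, vs j) \<in> parcs G then -1 else 0)"
  have "A i j = A j i" for i j
    using arc_swap by (auto simp: A_def)
  then obtain q l where
    orth: "\<And>i j. i < n \<Longrightarrow> j < n \<Longrightarrow> dotp n (q i) (q j) = (if i = j then 1 else 0)" and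
    eig: "\<And>j i. j < n \<Longrightarrow> i < n \<Longrightarrow> matvec n A (q j) i = l j * q j i" and
    mono: "\<And>i j. i \<le> j \<Longrightarrow> j < n \<Longrightarrow> l i \<le> l j"
    using symmetric_spectral[of n A] by metis
  define g where "g = the_inv_into {..<n} vs"
  have inj: "inj_on vs {..<n}" and img: "vs ` {..<n} = pverts G"
    using bij by (auto simp: bij_betw_def)
  have g_vs: "g (vs i) = i" if "i < n" for i
    using the_inv_into_f_f[OF inj] that by (simp add: g_def)
  have vs_g: "vs (g x) = x" "g x < n" if "x \<in> pverts G" for x
    using f_the_inv_into_f[OF inj, of x] the_inv_into_into[OF inj, of x] that
    by (auto simp: g_def img)
  have sum_V: "(\<Sum>x\<in>pverts G. h x) = (\<Sum>i<n. h (vs i))" for h :: "'a \<Rightarrow> real"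
    using sum.reindex[OF inj, of h] by (simp add: img)
  show ?thesis
  proof (rule that[of l "\<lambda>j x. q j (g x)"])
    show "ordered_eigenvalues (full_laplacian G vs) = map l [0..<n]"
      using ordered_eigenvalues_eq[of n q A l, OF orth eig mono]
      by (simp add: full_laplacian_def A_def n)
    show "l i \<le> l j" if "i \<le> j" "j < n" for i j
      using mono that .
    show "(\<Sum>x\<in>pverts G. q i (g x) * q j (g x)) = (if i = j then 1 else 0)" if "i < n" "j < n" for i j
      using orth[OF that] by (simp add: sum_V g_vs dotp_def)
    show "(\<Sum>j<n. q j (g x) * q j (g y)) = (if x = y then 1 else 0)"
      if "x \<in> pverts G" "y \<in> pverts G" for x y
      using orthonormal_complete[of n q "g x" "g y"] orth vs_g that by auto metis
    show "laplacian G (\<lambda>x. q j (g x)) x = l j * q j (g x)" if "j < n" "x \<in> pverts G" for j x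
    proof -
      have "laplacian G (\<lambda>x. q j (g x)) x = (\<Sum>b<n. A (g x) b * q j (g (vs b)))"
        using full_laplacian_entry_sum[OF bij vs_g(2)[OF that(2)], of "\<lambda>x. q j (g x)"] vs_g(1)[OF that(2)]
        by (simp add: A_def)
      also have "\<dots> = matvec n A (q j) (g x)"
        by (simp add: matvec_def g_vs)
      finally show ?thesis
        using eig[OF that(1) vs_g(2)[OF that(2)]] by simp
    qed
  qed
qed

text \<open>Applying the pseudo-inverse of the Laplacian to the dipole (point mass at
  \<open>u\<close> minus point mass at \<open>v\<close>) divides its coefficients by eigenvalues
  that are at least \<open>b\<close>. The squared norm of the dipole is 2.\<close>

lemma exists_small_dipole_potential:
  assumes conn: "Digraph_Component.connected (with_proj G)"
    and bij: "bij_betw vs {..<n} (pverts G)" and n: "n = card (pverts G)"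
    and uv: "u \<in> pverts G" "v \<in> pverts G" "u \<noteq> v"
  defines "b \<equiv> ordered_eigenvalues (full_laplacian G vs) ! 1"
  obtains f where
    "\<And>x. x \<in> pverts G \<Longrightarrow> laplacian G f x = of_bool (x = u) - of_bool (x = v)"
    "(\<Sum>x\<in>pverts G. (f x)\<^sup>2) \<le> 2 / b\<^sup>2"
proof -
  obtain Q l where
    ev: "ordered_eigenvalues (full_laplacian G vs) = map l [0..<n]" and
    mono: "\<And>i j. i \<le> j \<Longrightarrow> j < n \<Longrightarrow> l i \<le> l j" and
    orth: "\<And>i j. i < n \<Longrightarrow> j < n \<Longrightarrow> (\<Sum>x\<in>pverts G. Q i x * Q j x) = (if i = j then 1 else 0)" and
    compl: "\<And>x y. x \<in> pverts G \<Longrightarrow> y \<in> pverts G \<Longrightarrow> (\<Sum>j<n. Q j x * Q j y) = (if x = y then 1 else 0)" and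
    eig: "\<And>j x. j < n \<Longrightarrow> x \<in> pverts G \<Longrightarrow> laplacian G (Q j) x = l j * Q j x"
    by (rule laplacian_eigenbasis[OF bij n]) (rule that)
  have "card {u, v} \<le> n"
    unfolding n using uv pair_finite_verts by (intro card_mono) auto
  then have n2: "2 \<le> n"
    using uv by simp
  have b: "b = l 1"
    using n2 by (simp add: b_def ev)
  have rayleigh: "(\<Sum>x\<in>pverts G. Q j x * laplacian G (Q j) x) = l j" if "j < n" for j
  proof -
    have "(\<Sum>x\<in>pverts G. Q j x * laplacian G (Q j) x) = l j * (\<Sum>x\<in>pverts G. Q j x * Q j x)"
      using eig that by (simp add: sum_distrib_left algebra_simps)
    then show ?thesis
      using orth that by simp
  qed
  have l_nonneg: "0 \<le> l j" if "j < n" for j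
    using dirichlet_energy_nonneg[of "Q j"] rayleigh[OF that] by simp
  have const: "Q j x = Q j y" if "l j = 0" "j < n" "x \<in> pverts G" "y \<in> pverts G" for j x y
    using that eig by (intro laplacian_eq_0_imp_const[OF conn]) auto
  \<comment> \<open>If all eigenvalues were positive, every \<open>Q j\<close> would have sum 0,
    since Laplacians have sum 0; the expansion of the point mass at \<open>u\<close> would then have
    total 0 instead of 1.\<close>
  have l0: "l 0 = 0"
  proof (rule ccontr)
    assume "l 0 \<noteq> 0"
    then have pos: "0 < l j" if "j < n" for j
      using l_nonneg[of 0] mono[of 0 j] that by fastforce
    have sum0: "(\<Sum>x\<in>pverts G. Q j x) = 0" if "j < n" for j
    proof -
      have "l j * (\<Sum>x\<in>pverts G. Q j x) = (\<Sum>x\<in>pverts G. laplacian G (Q j) x)"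
        using eig that by (simp add: sum_distrib_left)
      then show ?thesis
        using sum_laplacian_verts pos[OF that] by simp
    qed
    have "1 = (\<Sum>y\<in>pverts G. if u = y then 1 else 0::real)"
      using uv pair_finite_verts by simp
    also have "\<dots> = (\<Sum>y\<in>pverts G. \<Sum>j<n. Q j u * Q j y)"
      using compl uv by (intro sum.cong) auto
    also have "\<dots> = (\<Sum>j<n. Q j u * (\<Sum>y\<in>pverts G. Q j y))"
      by (subst sum.swap) (simp add: sum_distrib_left)
    also have "\<dots> = 0"
      using sum0 by simp
    finally show False by simp
  qed
  \<comment> \<open>If \<open>l 1 = 0\<close>, then \<open>Q 0\<close> and \<open>Q 1\<close> are
    both constant, and two constant functions cannot be orthonormal.\<close>
  have l1: "0 < l 1"
  proof (rule ccontr)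
    assume "\<not> 0 < l 1"
    then have "l 1 = 0"
      using l_nonneg[of 1] n2 by simp
    have prod: "(\<Sum>x\<in>pverts G. Q i x * Q j x) = real n * (Q i u * Q j u)" if "i \<in> {0, 1}" "j \<in> {0, 1}" for i j
    proof -
      have "Q i x = Q i u" "Q j x = Q j u" if "x \<in> pverts G" for x
        using const[OF _ _ that uv(1)] l0 \<open>l 1 = 0\<close> n2 \<open>i \<in> {0, 1}\<close> \<open>j \<in> {0, 1}\<close> by auto
      then show ?thesis
        by (simp add: n)
    qed
    show False
      using prod[of 0 0] prod[of 0 1] prod[of 1 1] orth[of 0 0] orth[of 0 1] orth[of 1 1] n2 by auto
  qed
  \<comment> \<open>Index 0 is left out, as \<open>l 0 = 0\<close> cannot be inverted; the dipole
    has no component there because \<open>Q 0\<close> is constant.\<close>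
  define J where "J = {1..<n}"
  have ins: "{..<n} = insert 0 J" "0 \<notin> J" "finite J"
    using n2 by (auto simp: J_def)
  have lJ: "l 1 \<le> l j" "j < n" if "j \<in> J" for j
    using mono[of 1 j] that by (auto simp: J_def)
  \<comment> \<open>The coefficient of the dipole along \<open>Q j\<close>.\<close>
  define c where "c j = Q j u - Q j v" for j
  have c0: "c 0 = 0"
    using const[of 0 u v] l0 uv n2 by (simp add: c_def)
  define f where "f x = (\<Sum>j\<in>J. (c j / l j) * Q j x)" for x
  show ?thesis
  proof (rule that[of f])
    fix x assume x: "x \<in> pverts G"
    have "laplacian G f x = (\<Sum>j\<in>J. (c j / l j) * laplacian G (Q j) x)"
      unfolding f_def by (rule laplacian_lincomb)
    also have "\<dots> = (\<Sum>j\<in>J. c j * Q j x)"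
      using lJ l1 eig x by (intro sum.cong) fastforce+
    also have "\<dots> = (\<Sum>j<n. c j * Q j x)"
      using ins c0 by simp
    also have "\<dots> = of_bool (x = u) - of_bool (x = v)"
      using compl[OF uv(1) x] compl[OF uv(2) x] by (auto simp: c_def left_diff_distrib sum_subtractf)
    finally show "laplacian G f x = of_bool (x = u) - of_bool (x = v)" .
  next
    have "(\<Sum>x\<in>pverts G. (f x)\<^sup>2) =
        (\<Sum>x\<in>pverts G. \<Sum>i\<in>J. \<Sum>j\<in>J. (c i / l i) * (c j / l j) * (Q i x * Q j x))"
      by (simp add: f_def power2_eq_square sum_product algebra_simps)
    also have "\<dots> = (\<Sum>i\<in>J. \<Sum>x\<in>pverts G. \<Sum>j\<in>J. (c i / l i) * (c j / l j) * (Q i x * Q j x))"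
      by (rule sum.swap)
    also have "\<dots> = (\<Sum>i\<in>J. \<Sum>j\<in>J. (c i / l i) * (c j / l j) * (\<Sum>x\<in>pverts G. Q i x * Q j x))"
      unfolding sum_distrib_left by (intro sum.cong refl sum.swap)
    also have "\<dots> = (\<Sum>i\<in>J. \<Sum>j\<in>J. if i = j then (c i / l i) * (c j / l j) else 0)"
      using orth lJ by (intro sum.cong) auto
    also have "\<dots> = (\<Sum>i\<in>J. (c i / l i)\<^sup>2)"
      using ins(3) by (simp add: power2_eq_square)
    also have "\<dots> \<le> (\<Sum>i\<in>J. (c i)\<^sup>2 / (l 1)\<^sup>2)"
    proof (intro sum_mono)
      fix i assume "i \<in> J"
      then have "(l 1)\<^sup>2 \<le> (l i)\<^sup>2"
        using lJ l1 by (intro power_mono) auto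
      then show "(c i / l i)\<^sup>2 \<le> (c i)\<^sup>2 / (l 1)\<^sup>2"
        unfolding power_divide using l1 by (intro divide_left_mono mult_pos_pos) (auto simp: less_le_trans[of 0 "(l 1)\<^sup>2"])
    qed
    also have "\<dots> = (\<Sum>j<n. (c j)\<^sup>2) / (l 1)\<^sup>2"
      using ins c0 by (simp add: sum_divide_distrib)
    \<comment> \<open>Parseval for the dipole: completeness evaluates the three sums to 1, 0 and
      1.\<close>
    also have "(\<Sum>j<n. (c j)\<^sup>2) = (\<Sum>j<n. Q j u * Q j u) - 2 * (\<Sum>j<n. Q j u * Q j v) + (\<Sum>j<n. Q j v * Q j v)"
      by (simp add: c_def power2_eq_square sum_distrib_left sum.distrib[symmetric] sum_subtractf[symmetric] algebra_simps)
    also have "\<dots> = 2"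
      using compl uv by simp
    finally show "(\<Sum>x\<in>pverts G. (f x)\<^sup>2) \<le> 2 / b\<^sup>2"
      by (simp add: b)
  qed
qed

end

section \<open>Multiplicative harmonic functions\<close>

text \<open>Half-angle formula and \<open>\<bar>sin y\<bar> \<le> \<bar>y\<bar>\<close>.\<close>

lemma cos_ge: "1 - x\<^sup>2 / 2 \<le> cos (x::real)"
proof -
  have "cos x = 1 - 2 * (sin (x / 2))\<^sup>2"
    using cos_double_sin[of "x / 2"] by simp
  moreover have "(sin (x / 2))\<^sup>2 \<le> (x / 2)\<^sup>2"
    using abs_sin_x_le_abs_x[of "x / 2"] by (simp only: abs_le_square_iff)
  ultimately show ?thesis
    by (simp add: power2_eq_square)
qed

lemma cis_prod: "cis (\<Sum>x\<in>A. f x) = (\<Prod>x\<in>A. cis (f x))"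
  by (induction A rule: infinite_finite_induct) (auto simp flip: cis_mult)

context pair_graph
begin

text \<open>\<open>cis\<close> maps the Laplacian of the phases to the quotient of the two sides of
  the harmonicity condition.\<close>

lemma cis_harmonic_iff:
  "cis (t v) ^ out_degree (with_proj G) v = (\<Prod>w | (v, w) \<in> parcs G. cis (t w)) \<longleftrightarrow>
    cis (laplacian G t v) = 1"
proof -
  have "cis (laplacian G t v) =
      cis (t v) ^ out_degree (with_proj G) v / (\<Prod>w | (v, w) \<in> parcs G. cis (t w))"
    by (simp add: laplacian_eq_degree cis_divide[symmetric] cis_prod DeMoivre mult.commute)
  moreover have "(\<Prod>w | (v, w) \<in> parcs G. cis (t w)) \<noteq> 0"
    by (metis cis_neq_zero cis_prod)
  ultimately show ?thesis by auto
qed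

text \<open>\<open>ln (cmod (h x))\<close> is harmonic in the additive sense, hence constant, and it
  is 0 at the sink.\<close>

lemma mult_harmonic_norm_eq_1:
  assumes conn: "Digraph_Component.connected (with_proj G)" and s: "s \<in> pverts G"
    and h: "h \<in> mult_harmonic G s" and v: "v \<in> pverts G"
  shows "cmod (h v) = 1"
proof -
  have nz: "h x \<noteq> 0" if "x \<in> pverts G" for x
    using h that by (auto simp: mult_harmonic_def)
  have "laplacian G (\<lambda>x. ln (cmod (h x))) x = 0" if x: "x \<in> pverts G" for x
  proof -
    have "cmod (h x) ^ out_degree (with_proj G) x = (\<Prod>w | (x, w) \<in> parcs G. cmod (h w))"
      using h x by (simp add: mult_harmonic_def norm_power[symmetric] prod_norm)
    then have "ln (cmod (h x) ^ out_degree (with_proj G) x) = ln (\<Prod>w | (x, w) \<in> parcs G. cmod (h w))"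
      by simp
    also have "\<dots> = (\<Sum>w | (x, w) \<in> parcs G. ln (cmod (h w)))"
      using nz in_arcsD2 by (intro ln_prod) auto
    finally show ?thesis
      using nz[OF x] by (simp add: laplacian_eq_degree ln_realpow)
  qed
  then have "ln (cmod (h v)) = ln (cmod (h s))"
    by (rule laplacian_eq_0_imp_const[OF conn _ v s])
  also have "\<dots> = 0"
    using h by (simp add: mult_harmonic_def)
  finally show ?thesis
    using nz[OF v] by simp
qed

text \<open>
  The integer vector \<open>\<Delta>(Arg h) / 2\<pi>\<close> is bounded and determines \<open>h\<close>, because the kernel of the
  Laplacian consists of the constants and \<open>Arg (h s) = 0\<close>.
\<close>
lemma finite_mult_harmonic:
  assumes conn: "Digraph_Component.connected (with_proj G)" and s: "s \<in> pverts G"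
  shows "finite (mult_harmonic G s)"
proof -
  define k where "k h = (\<lambda>v\<in>pverts G. laplacian G (\<lambda>x. Arg (h x)) v / (2 * pi))" for h :: "'a \<Rightarrow> complex"
  have cis_Arg_h: "cis (Arg (h v)) = h v" if "h \<in> mult_harmonic G s" "v \<in> pverts G" for h v
    using mult_harmonic_norm_eq_1[OF conn s that] rcis_cmod_Arg[of "h v"] by (simp add: rcis_def)
  have "k ` mult_harmonic G s \<subseteq> (\<Pi>\<^sub>E v\<in>pverts G. real_of_int ` {- int (card (pverts G))..int (card (pverts G))})"
  proof clarify
    fix h assume h: "h \<in> mult_harmonic G s"
    have "laplacian G (\<lambda>x. Arg (h x)) v / (2 * pi) \<in> real_of_int ` {- int (card (pverts G))..int (card (pverts G))}"
      if v: "v \<in> pverts G" for v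
    proof -
      \<comment> \<open>All values have modulus 1, so \<open>h = cis (Arg h)\<close> on the vertices
        and the Laplacian of the arguments is a multiple of \<open>2 * pi\<close>.\<close>
      have "cis (laplacian G (\<lambda>x. Arg (h x)) v) = 1"
        using h v cis_Arg_h[OF h] in_arcsD2
        by (subst cis_harmonic_iff[symmetric]) (auto simp: mult_harmonic_def intro!: prod.cong)
      then have "cos (laplacian G (\<lambda>x. Arg (h x)) v) = 1"
        by (metis cis.sel(1) one_complex.sel(1))
      then obtain m :: int where m: "laplacian G (\<lambda>x. Arg (h x)) v = m * 2 * pi"
        by (auto simp: cos_one_2pi_int)
      \<comment> \<open>Two principal arguments differ by at most \<open>2 * pi\<close>, and a
        vertex has at most \<open>card (pverts G)\<close> neighbours.\<close>
      have "\<bar>laplacian G (\<lambda>x. Arg (h x)) v\<bar> \<le> (\<Sum>w | (v, w) \<in> parcs G. \<bar>Arg (h v) - Arg (h w)\<bar>)"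
        unfolding laplacian_def by (rule sum_abs)
      also have "\<dots> \<le> (\<Sum>w | (v, w) \<in> parcs G. 2 * pi)"
      proof (rule sum_mono)
        fix w
        show "\<bar>Arg (h v) - Arg (h w)\<bar> \<le> 2 * pi"
          using Arg_bounded[of "h v"] Arg_bounded[of "h w"] by linarith
      qed
      also have "\<dots> \<le> card (pverts G) * (2 * pi)"
        using card_mono[OF pair_finite_verts neighbours_subset[of v]] by (simp add: mult_right_mono)
      finally have "\<bar>real_of_int m\<bar> * (2 * pi) \<le> card (pverts G) * (2 * pi)"
        by (simp add: m abs_mult)
      then have "\<bar>real_of_int m\<bar> \<le> card (pverts G)"
        by (rule mult_right_le_imp_le) simp
      then have "m \<in> {- int (card (pverts G))..int (card (pverts G))}"
        by (simp add: abs_le_iff)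
      then show ?thesis
        using m by auto
    qed
    then show "k h \<in> (\<Pi>\<^sub>E v\<in>pverts G. real_of_int ` {- int (card (pverts G))..int (card (pverts G))})"
      by (simp add: k_def PiE_iff)
  qed
  moreover have "finite (\<Pi>\<^sub>E v\<in>pverts G. real_of_int ` {- int (card (pverts G))..int (card (pverts G))})"
    using pair_finite_verts by (intro finite_PiE) auto
  ultimately have "finite (k ` mult_harmonic G s)"
    by (rule finite_subset)
  moreover have "inj_on k (mult_harmonic G s)"
  proof (rule inj_onI)
    fix h h' assume h: "h \<in> mult_harmonic G s" and h': "h' \<in> mult_harmonic G s" and eq: "k h = k h'"
    have "laplacian G (\<lambda>x. Arg (h x) - Arg (h' x)) v = 0" if v: "v \<in> pverts G" for v
    proof -
      have "laplacian G (\<lambda>x. Arg (h x)) v = laplacian G (\<lambda>x. Arg (h' x)) v"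
        using fun_cong[OF eq, of v] v by (simp add: k_def)
      then show ?thesis
        by (simp add: laplacian_eq_degree sum_subtractf algebra_simps)
    qed
    from laplacian_eq_0_imp_const[OF conn this _ s]
    have "Arg (h v) - Arg (h' v) = Arg (h s) - Arg (h' s)" if "v \<in> pverts G" for v
      using that by simp
    then have "Arg (h v) = Arg (h' v)" if "v \<in> pverts G" for v
      using that h h' by (simp add: mult_harmonic_def)
    then have "h v = h' v" if "v \<in> pverts G" for v
      using cis_Arg_h[OF h that] cis_Arg_h[OF h' that] that by metis
    then show "h = h'"
      using h h' by (auto simp: mult_harmonic_def intro!: PiE_ext[of h "pverts G" "\<lambda>_. UNIV - {0}"])
  qed
  ultimately show ?thesis
    by (rule finite_imageD)
qed

text \<open>The phases \<open>2 * pi * (f x - f s)\<close> define a test function \<open>h\<close>: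
  the integral Laplacian makes it harmonic, the nonintegral difference makes it nontrivial, and the
  quadratic bound on the cosine estimates its eigenvalue.\<close>

lemma discrete_spectral_gap_le:
  assumes conn: "Digraph_Component.connected (with_proj G)" and s: "s \<in> pverts G"
    and lap: "\<And>x. x \<in> pverts G \<Longrightarrow> laplacian G f x \<in> \<int>"
    and x: "x \<in> pverts G" "f x - f s \<notin> \<int>"
  shows "discrete_spectral_gap G s \<le> 2 * pi\<^sup>2 / card (pverts G) * (\<Sum>x\<in>pverts G. (f x)\<^sup>2)"
proof -
  define N where "N = real (card (pverts G))"
  have N: "N > 0"
    using s pair_finite_verts by (auto simp: N_def card_gt_0_iff)
  define h where "h = (\<lambda>x\<in>pverts G. cis (2 * pi * (f x - f s)))"
  have "h \<in> mult_harmonic G s"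
    unfolding mult_harmonic_def
  proof (intro CollectI conjI ballI)
    show "h \<in> pverts G \<rightarrow>\<^sub>E UNIV - {0}" "h s = 1"
      using s by (auto simp: h_def)
    fix v assume v: "v \<in> pverts G"
    have "cis (laplacian G (\<lambda>x. 2 * pi * (f x - f s)) v) = cis (2 * pi * laplacian G f v)"
      by (simp add: laplacian_def sum_distrib_left algebra_simps)
    also have "\<dots> = 1"
      using lap[OF v] by simp
    finally show "h v ^ out_degree (with_proj G) v = (\<Prod>w | (v, w) \<in> parcs G. h w)"
      using v in_arcsD2 cis_harmonic_iff[of "\<lambda>x. 2 * pi * (f x - f s)" v]
      by (auto simp: h_def intro!: prod.cong)
  qed
  moreover have "h x \<noteq> 1"
  proof
    assume "h x = 1"
    then have "cos (2 * pi * (f x - f s)) = 1"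
      using x by (simp add: h_def complex_eq_iff)
    then obtain m :: int where "2 * pi * (f x - f s) = m * 2 * pi"
      by (auto simp: cos_one_2pi_int)
    then have "f x - f s = m"
      by simp
    then show False
      using x by simp
  qed
  ultimately have "1 - cmod (sandpile_eigenvalue G h) \<in> {1 - cmod (sandpile_eigenvalue G h) | h.
       h \<in> mult_harmonic G s \<and> (\<exists>v \<in> pverts G. h v \<noteq> 1)}"
    using x by blast
  \<comment> \<open>\<open>Min\<close> bounds its elements from below only for a finite set, hence
    the use of \<open>finite_mult_harmonic\<close>.\<close>
  then have "discrete_spectral_gap G s \<le> 1 - cmod (sandpile_eigenvalue G h)"
    unfolding discrete_spectral_gap_def
    using finite_mult_harmonic[OF conn s] by (intro Min_le) auto
  moreover have "1 - 2 * pi\<^sup>2 / N * (\<Sum>x\<in>pverts G. (f x)\<^sup>2) \<le> cmod (sandpile_eigenvalue G h)"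
  proof -
    have "N - 2 * pi\<^sup>2 * (\<Sum>x\<in>pverts G. (f x)\<^sup>2) = (\<Sum>x\<in>pverts G. 1 - (2 * pi * f x)\<^sup>2 / 2)"
      by (simp add: N_def sum_subtractf sum_distrib_left power_mult_distrib mult.assoc)
    also have "\<dots> \<le> (\<Sum>x\<in>pverts G. cos (2 * pi * f x))"
      by (intro sum_mono cos_ge)
    also have "\<dots> = Re (\<Sum>x\<in>pverts G. cis (2 * pi * f x))"
      by simp
    also have "\<dots> \<le> cmod (\<Sum>x\<in>pverts G. cis (2 * pi * f x))"
      by (rule complex_Re_le_cmod)
    \<comment> \<open>Normalising at the sink only contributes a factor of modulus 1, so the bound
      involves \<open>f\<close> itself and not \<open>f - f s\<close>.\<close>
    also have "(\<Sum>x\<in>pverts G. cis (2 * pi * f x)) = cis (2 * pi * f s) * (\<Sum>x\<in>pverts G. h x)"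
      by (simp add: h_def sum_distrib_left cis_mult algebra_simps)
    also have "cmod \<dots> = N * cmod (sandpile_eigenvalue G h)"
      using N by (simp add: sandpile_eigenvalue_def norm_mult norm_divide N_def)
    finally show ?thesis
      using N by (simp add: field_simps)
  qed
  ultimately show ?thesis
    by (simp add: N_def)
qed

end

section \<open>Gap bound from the dipole potential across a cycle arc\<close>

theorem theorem1p4:
  fixes G :: "'a pair_pre_digraph" and s :: 'a and n :: nat
    and vs :: "nat \<Rightarrow> 'a" and \<beta> :: "nat \<Rightarrow> real"
  assumes "pair_graph G"
    and "Digraph_Component.connected (with_proj G)"
    and "\<not> undirected_tree G"
    and "s \<in> pverts G"
    and "n = card (pverts G)"
    and "bij_betw vs {..<n} (pverts G)"
    and "\<And>i. i < n \<Longrightarrow> \<beta> i = ordered_eigenvalues (full_laplacian G vs) ! i"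
  shows "discrete_spectral_gap G s \<le> 4 * pi ^ 2 / (\<beta> 1 ^ 2 * real n)"
proof -
  interpret pair_graph G by fact
  note conn = assms(2) and s = assms(4) and n = assms(5) and bij = assms(6)
  obtain u v p where uv: "(u, v) \<in> parcs G" "pcas v p u" "set p \<subseteq> parcs G" "(v, u) \<notin> set p"
    using not_tree_imp_cycle_arc[OF conn assms(3)] by metis
  have V: "u \<in> pverts G" "v \<in> pverts G" "u \<noteq> v"
    using uv(1) in_arcsD1 in_arcsD2 pair_no_loops[of "(u, v)"] by auto
  \<comment> \<open>\<open>\<beta>\<close> is specified only below \<open>n\<close>, so index 1
    requires \<open>n \<ge> 2\<close>; the two endpoints of the arc provide this.\<close>
  have "card {u, v} \<le> n"
    unfolding n using V pair_finite_verts by (intro card_mono) auto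
  then have \<beta>: "ordered_eigenvalues (full_laplacian G vs) ! 1 = \<beta> 1"
    using assms(7)[of 1] V by simp
  obtain f where
    lap: "\<And>x. x \<in> pverts G \<Longrightarrow> laplacian G f x = of_bool (x = u) - of_bool (x = v)" and
    f: "(\<Sum>x\<in>pverts G. (f x)\<^sup>2) \<le> 2 / (\<beta> 1)\<^sup>2"
    using exists_small_dipole_potential[OF conn bij n V] unfolding \<beta> by metis
  \<comment> \<open>Otherwise \<open>f - f s\<close>, which has the same Laplacian as
    \<open>f\<close>, would be an integral potential for an arc on a cycle, contradicting
    \<open>dipole_not_integral\<close>.\<close>
  obtain x where x: "x \<in> pverts G" "f x - f s \<notin> \<int>"
  proof (rule ccontr)
    assume "\<not> thesis"
    then have "f x - f s \<in> \<int>" if "x \<in> pverts G" for x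
      using that \<open>\<And>x. x \<in> pverts G \<Longrightarrow> f x - f s \<notin> \<int> \<Longrightarrow> thesis\<close> by blast
    moreover have "laplacian G (\<lambda>x. f x - f s) x = laplacian G f x" for x
      by (simp add: laplacian_def)
    ultimately show False
      using dipole_not_integral[OF conn uv(2-4) uv(1), of "\<lambda>x. f x - f s"] lap by simp
  qed
  have "discrete_spectral_gap G s \<le> 2 * pi\<^sup>2 / n * (\<Sum>x\<in>pverts G. (f x)\<^sup>2)"
    unfolding n by (rule discrete_spectral_gap_le[OF conn s _ x]) (simp add: lap of_bool_def)
  also have "\<dots> \<le> 2 * pi\<^sup>2 / n * (2 / (\<beta> 1)\<^sup>2)"
    by (intro mult_left_mono f) simp
  also have "\<dots> = 4 * pi ^ 2 / (\<beta> 1 ^ 2 * real n)"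
    by simp
  finally show ?thesis .
qed

end
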